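(* Let $R$ be an additively cancellative, zerosumfree, yoked, commutative semiring, let $S\subsetneq R$ be a multiplicative subset, and suppose that $R$ is $S$-Noetherian. Then every $S$-$k$-irreducible ideal of $R$ is an $S$-$k$-primary ideal of $R$.
   Context: Semirings are commutative with unity $1$ and zero $0$. A multiplicative subset of $R$ is a nonempty subset $S\subsetneq R$ with $1\in S$ and $s_1s_2\in S$ for all $s_1,s_2\in S$. $R$ is additively cancellative if $a+c=b+c$ implies $a=b$; zerosumfree if $a+b=0$ implies $a=b=0$; yoked if for all $a,b\in R$ there is $r\in R$ with $a+r=b$ or $b+r=a$. An ideal $I$ of $R$ is a $k$-ideal if $a+b\in I$ and $a\in I$ imply $b\in I$. The radical of an ideal $I$ is $\sqrt I=\{x\in R: x^n\in I \text{ for some } n\in\mathbb N\}$, $n\geq 1$. An ideal $I$ with $I\cap S=\varnothing$ is $S$-finite if there exist $s\in S$ and a finitely generated ideal $J$ of $R$ with $sI\subseteq J\subseteq I$. $R$ is $S$-Noetherian if every ideal of $R$ disjoint from $S$ is $S$-finite. A $k$-ideal $A$ of $R$ with $A\cap S=\varnothing$ is $S$-$k$-irreducible if, whenever $s(I\cap J)\subseteq A\subseteq I\cap J$ for some $s\in S$ and some $k$-ideals $I,J$ of $R$, there exists $s'\in S$ such that $ss'I\subseteq A$ or $ss'J\subseteq A$. An ideal $A$ with $A\cap S=\varnothing$ is $S$-primary if there exists $s\in S$ such that for all $a,b\in R$, $ab\in A$ implies $sa\in A$ or $sb\in\sqrt A$. It is $S$-$k$-primary if it is both $S$-primary and a $k$-ideal.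 *)

theory Defs
  imports Main "HOL.Hull"
begin

text \<open>
  The semiring \<open>R\<close> is the universe of a type of class \<^class>\<open>comm_semiring_1\<close>. This class
  requires \<open>0 \<noteq> 1\<close>, which is no restriction for semirings having a multiplicative subset: such a
  set is proper and contains \<open>1\<close>, so it cannot exist when \<open>R = {0}\<close>.
  The class \<^class>\<open>comm_semiring_1_cancel\<close> is not used for additive cancellation, because it also
  demands a subtraction over which multiplication distributes.
\<close>

definition additively_cancellative :: "'a::comm_semiring_1 itself \<Rightarrow> bool" where
  "additively_cancellative _ \<longleftrightarrow> (\<forall>a b c :: 'a. a + c = b + c \<longrightarrow> a = b)"

definition zerosumfree :: "'a::comm_semiring_1 itself \<Rightarrow> bool" where
  "zerosumfree _ \<longleftrightarrow> (\<forall>a b :: 'a. a + b = 0 \<longrightarrow> a = 0 \<and> b = 0)"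

definition yoked :: "'a::comm_semiring_1 itself \<Rightarrow> bool" where
  "yoked _ \<longleftrightarrow> (\<forall>a b :: 'a. \<exists>r. a + r = b \<or> b + r = a)"

definition multiplicative_subset :: "'a::comm_semiring_1 set \<Rightarrow> bool" where
  "multiplicative_subset S \<longleftrightarrow>
     S \<noteq> {} \<and> S \<subset> UNIV \<and> 1 \<in> S \<and> (\<forall>s\<in>S. \<forall>t\<in>S. s * t \<in> S)"

text \<open>Ideals need not be proper.\<close>

definition semiring_ideal :: "'a::comm_semiring_1 set \<Rightarrow> bool" where
  "semiring_ideal I \<longleftrightarrow>
     I \<noteq> {} \<and> (\<forall>a\<in>I. \<forall>b\<in>I. a + b \<in> I) \<and> (\<forall>r. \<forall>a\<in>I. r * a \<in> I)"

definition k_ideal :: "'a::comm_semiring_1 set \<Rightarrow> bool" where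
  "k_ideal I \<longleftrightarrow> semiring_ideal I \<and> (\<forall>a b. a + b \<in> I \<and> a \<in> I \<longrightarrow> b \<in> I)"

definition radical :: "'a::comm_semiring_1 set \<Rightarrow> 'a set" where
  "radical I = {x. \<exists>n\<ge>1. x ^ n \<in> I}"

definition finitely_generated_ideal :: "'a::comm_semiring_1 set \<Rightarrow> bool" where
  "finitely_generated_ideal J \<longleftrightarrow> (\<exists>F. finite F \<and> J = semiring_ideal hull F)"

definition S_finite :: "'a::comm_semiring_1 set \<Rightarrow> 'a set \<Rightarrow> bool" where
  "S_finite S I \<longleftrightarrow> semiring_ideal I \<and> I \<inter> S = {} \<and>
     (\<exists>s\<in>S. \<exists>J. finitely_generated_ideal J \<and> (*) s ` I \<subseteq> J \<and> J \<subseteq> I)"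

definition S_Noetherian :: "'a::comm_semiring_1 set \<Rightarrow> bool" where
  "S_Noetherian S \<longleftrightarrow> (\<forall>I. semiring_ideal I \<and> I \<inter> S = {} \<longrightarrow> S_finite S I)"

definition S_k_irreducible :: "'a::comm_semiring_1 set \<Rightarrow> 'a set \<Rightarrow> bool" where
  "S_k_irreducible S A \<longleftrightarrow> k_ideal A \<and> A \<inter> S = {} \<and>
     (\<forall>s\<in>S. \<forall>I J. k_ideal I \<and> k_ideal J \<and> (*) s ` (I \<inter> J) \<subseteq> A \<and> A \<subseteq> I \<inter> J \<longrightarrow>
        (\<exists>s'\<in>S. (*) (s * s') ` I \<subseteq> A \<or> (*) (s * s') ` J \<subseteq> A))"

definition S_primary :: "'a::comm_semiring_1 set \<Rightarrow> 'a set \<Rightarrow> bool" where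
  "S_primary S A \<longleftrightarrow> semiring_ideal A \<and> A \<inter> S = {} \<and>
     (\<exists>s\<in>S. \<forall>a b. a * b \<in> A \<longrightarrow> s * a \<in> A \<or> s * b \<in> radical A)"

definition S_k_primary :: "'a::comm_semiring_1 set \<Rightarrow> 'a set \<Rightarrow> bool" where
  "S_k_primary S A \<longleftrightarrow> S_primary S A \<and> k_ideal A"

end

theory Submission
  imports Defs
begin

text \<open>
  Let \<open>A\<close> be \<open>S\<close>-\<open>k\<close>-irreducible. Applying the \<open>S\<close>-Noetherian condition to the directed union of
  the ideals \<open>(A : s)\<close>, \<open>s \<in> S\<close>, gives a single \<open>u \<in> S\<close> such that \<open>s x \<in> A\<close> with \<open>s \<in> S\<close> implies
  \<open>u x \<in> A\<close>; this makes the constant in the definition of \<open>S\<close>-primary independent of the two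
  factors. Given \<open>a b \<in> A\<close>, either some \<open>s b\<^sup>n\<close> with \<open>s \<in> S\<close> lies in \<open>A\<close>, or the union of the chain
  \<open>(A : b\<^sup>n)\<close> is disjoint from \<open>S\<close>, so that \<open>t (A : b\<^sup>n) \<subseteq> (A : b\<^sup>k)\<close> for fixed \<open>t \<in> S\<close> and \<open>k\<close> and
  all \<open>n\<close>. In the second case \<open>t\<close> multiplies the intersection of the \<open>k\<close>-ideals generated by
  \<open>A \<union> {a}\<close> and \<open>A \<union> {b\<^sup>k}\<close> into \<open>A\<close>, and irreducibility applies.
\<close>

lemma semiring_idealD:
  assumes "semiring_ideal I"
  shows semiring_ideal_add: "a \<in> I \<Longrightarrow> b \<in> I \<Longrightarrow> a + b \<in> I"
    and semiring_ideal_mult: "a \<in> I \<Longrightarrow> r * a \<in> I"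
    and semiring_ideal_zero: "0 \<in> I"
proof -
  show *: "r * a \<in> I" if "a \<in> I" for a r
    using assms that by (auto simp: semiring_ideal_def)
  show "a + b \<in> I" if "a \<in> I" "b \<in> I" for a b
    using assms that by (auto simp: semiring_ideal_def)
  obtain a where "a \<in> I"
    using assms by (auto simp: semiring_ideal_def)
  then show "0 \<in> I"
    using *[of a 0] by simp
qed

lemma k_idealD:
  assumes "k_ideal I"
  shows k_ideal_imp_semiring_ideal: "semiring_ideal I"
    and k_ideal_cancel: "a + b \<in> I \<Longrightarrow> a \<in> I \<Longrightarrow> b \<in> I"
  using assms unfolding k_ideal_def by blast+

definition ideal_quotient :: "'a::comm_semiring_1 set \<Rightarrow> 'a \<Rightarrow> 'a set" where
  "ideal_quotient A c = {x. c * x \<in> A}"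

lemma mem_ideal_quotient [simp]: "x \<in> ideal_quotient A c \<longleftrightarrow> c * x \<in> A"
  by (simp add: ideal_quotient_def)

lemma semiring_ideal_quotient:
  assumes "semiring_ideal A"
  shows "semiring_ideal (ideal_quotient A c)"
  unfolding semiring_ideal_def
proof (intro conjI ballI allI)
  show "ideal_quotient A c \<noteq> {}"
    using semiring_ideal_zero[OF assms] by (auto simp: ideal_quotient_def intro!: exI[of _ 0])
  show "x + y \<in> ideal_quotient A c" if "x \<in> ideal_quotient A c" "y \<in> ideal_quotient A c" for x y
    using that by (simp add: distrib_left semiring_ideal_add[OF assms])
  show "r * x \<in> ideal_quotient A c" if "x \<in> ideal_quotient A c" for r x
    using that semiring_ideal_mult[OF assms, of "c * x" r] by (simp add: mult.left_commute)
qed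

lemma ideal_quotient_mono:
  assumes "semiring_ideal A"
  shows "ideal_quotient A c \<subseteq> ideal_quotient A (d * c)"
  by (auto simp: mult.assoc intro: semiring_ideal_mult[OF assms])

text \<open>For an ideal \<open>A\<close> this is the least k-ideal containing \<open>A\<close> and
  \<open>c\<close>. The elements \<open>p + r * c\<close> and \<open>q + r' * c\<close> range over
  the ideal generated by \<open>A\<close> and \<open>c\<close>, and the equation makes
  \<open>x\<close> a difference of two such elements without using subtraction.\<close>

definition k_adjoin :: "'a::comm_semiring_1 set \<Rightarrow> 'a \<Rightarrow> 'a set" where
  "k_adjoin A c = {x. \<exists>p\<in>A. \<exists>q\<in>A. \<exists>r r'. x + (p + r * c) = q + r' * c}"

lemma k_adjoinI: "p \<in> A \<Longrightarrow> q \<in> A \<Longrightarrow> x + (p + r * c) = q + r' * c \<Longrightarrow> x \<in> k_adjoin A c"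
  unfolding k_adjoin_def by blast

lemma k_adjoinE:
  assumes "x \<in> k_adjoin A c"
  obtains p q r r' where "p \<in> A" "q \<in> A" "x + (p + r * c) = q + r' * c"
  using assms unfolding k_adjoin_def by blast

lemma
  assumes "semiring_ideal A"
  shows subset_k_adjoin: "A \<subseteq> k_adjoin A c"
    and mem_k_adjoin: "c \<in> k_adjoin A c"
proof
  note zero = semiring_ideal_zero[OF assms]
  show "x \<in> k_adjoin A c" if "x \<in> A" for x
    using zero that by (rule k_adjoinI[of _ _ _ _ 0 _ 0]) simp
  show "c \<in> k_adjoin A c"
    using zero zero by (rule k_adjoinI[of _ _ _ _ 0 _ 1]) simp
qed

lemma k_ideal_k_adjoin:
  assumes A: "semiring_ideal A"
  shows "k_ideal (k_adjoin A c)"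
  unfolding k_ideal_def semiring_ideal_def
proof (intro conjI ballI allI impI)
  show "k_adjoin A c \<noteq> {}"
    using mem_k_adjoin[OF A] by blast
next
  fix x y assume "x \<in> k_adjoin A c" "y \<in> k_adjoin A c"
  then obtain p q r r' p2 q2 r2 r2'
    where pq: "p \<in> A" "q \<in> A" "p2 \<in> A" "q2 \<in> A"
      and x: "x + (p + r * c) = q + r' * c" and y: "y + (p2 + r2 * c) = q2 + r2' * c"
    by (elim k_adjoinE)
  have "(x + y) + ((p + p2) + (r + r2) * c) = (x + (p + r * c)) + (y + (p2 + r2 * c))"
    by (simp add: algebra_simps)
  also have "\<dots> = (q + q2) + (r' + r2') * c"
    unfolding x y by (simp add: algebra_simps)
  finally show "x + y \<in> k_adjoin A c"
    using pq semiring_ideal_add[OF A] by (blast intro: k_adjoinI)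
next
  fix s x assume "x \<in> k_adjoin A c"
  then obtain p q r r' where pq: "p \<in> A" "q \<in> A" and x: "x + (p + r * c) = q + r' * c"
    by (elim k_adjoinE)
  have "s * x + (s * p + (s * r) * c) = s * (x + (p + r * c))"
    by (simp add: algebra_simps)
  also have "\<dots> = s * q + (s * r') * c"
    unfolding x by (simp add: algebra_simps)
  finally show "s * x \<in> k_adjoin A c"
    using pq semiring_ideal_mult[OF A] by (blast intro: k_adjoinI)
next
  fix x y assume "x + y \<in> k_adjoin A c \<and> x \<in> k_adjoin A c"
  then obtain p q r r' p2 q2 r2 r2'
    where pq: "p \<in> A" "q \<in> A" "p2 \<in> A" "q2 \<in> A"
      and xy: "(x + y) + (p + r * c) = q + r' * c" and x: "x + (p2 + r2 * c) = q2 + r2' * c"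
    by (elim conjE k_adjoinE)
  \<comment> \<open>The summand \<open>q2 + r2' * c\<close> is added so that the equation for
    \<open>x\<close>, read backwards, supplies the \<open>x\<close> that completes \<open>y\<close>
    to \<open>x + y\<close>.\<close>
  have "y + ((p + q2) + (r + r2') * c) = y + (p + r * c) + (q2 + r2' * c)"
    by (simp add: algebra_simps)
  also have "\<dots> = ((x + y) + (p + r * c)) + (p2 + r2 * c)"
    unfolding x[symmetric] by (simp add: algebra_simps)
  also have "\<dots> = (q + p2) + (r' + r2) * c"
    unfolding xy by (simp add: algebra_simps)
  finally show "y \<in> k_adjoin A c"
    using pq semiring_ideal_add[OF A] by (blast intro: k_adjoinI)
qed

lemma finite_subset_directed_UN:
  assumes "finite F" and "D \<noteq> {}" and "F \<subseteq> (\<Union>i\<in>D. I i)"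
    and directed: "\<And>i j. i \<in> D \<Longrightarrow> j \<in> D \<Longrightarrow> \<exists>k\<in>D. I i \<union> I j \<subseteq> I k"
  shows "\<exists>k\<in>D. F \<subseteq> I k"
  using assms(1,3)
proof (induction F)
  case empty
  then show ?case using \<open>D \<noteq> {}\<close> by blast
next
  case (insert x F)
  then obtain i j where "i \<in> D" "F \<subseteq> I i" "j \<in> D" "x \<in> I j"
    by blast
  with directed[of i j] show ?case by blast
qed

lemma semiring_ideal_directed_UN:
  assumes "D \<noteq> {}" and ideal: "\<And>i. i \<in> D \<Longrightarrow> semiring_ideal (I i)"
    and directed: "\<And>i j. i \<in> D \<Longrightarrow> j \<in> D \<Longrightarrow> \<exists>k\<in>D. I i \<union> I j \<subseteq> I k"
  shows "semiring_ideal (\<Union>i\<in>D. I i)"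
  unfolding semiring_ideal_def
proof (intro conjI ballI allI)
  show "(\<Union>i\<in>D. I i) \<noteq> {}"
    using \<open>D \<noteq> {}\<close> semiring_ideal_zero[OF ideal] by blast
  show "x + y \<in> (\<Union>i\<in>D. I i)" if xy: "x \<in> (\<Union>i\<in>D. I i)" "y \<in> (\<Union>i\<in>D. I i)" for x y
  proof -
    obtain i j where "i \<in> D" "x \<in> I i" "j \<in> D" "y \<in> I j"
      using xy by blast
    moreover from this obtain k where "k \<in> D" "I i \<union> I j \<subseteq> I k"
      using directed by blast
    ultimately have "x + y \<in> I k"
      by (intro semiring_ideal_add[OF ideal]) auto
    with \<open>k \<in> D\<close> show ?thesis ..
  qed
  show "r * x \<in> (\<Union>i\<in>D. I i)" if "x \<in> (\<Union>i\<in>D. I i)" for r x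
    using that by (auto intro: semiring_ideal_mult[OF ideal])
qed

text \<open>This is an ascending chain condition up to a multiplier. With \<open>U\<close> the
  union, some finitely generated ideal lies between \<open>s U\<close> and \<open>U\<close>; by
  directedness its generators all lie in one member, which therefore contains
  \<open>s U\<close>.\<close>

lemma S_Noetherian_directed_stationary:
  assumes "S_Noetherian S" and "D \<noteq> {}"
    and ideal: "\<And>i. i \<in> D \<Longrightarrow> semiring_ideal (I i)"
    and directed: "\<And>i j. i \<in> D \<Longrightarrow> j \<in> D \<Longrightarrow> \<exists>k\<in>D. I i \<union> I j \<subseteq> I k"
    and disjoint: "\<And>i. i \<in> D \<Longrightarrow> I i \<inter> S = {}"
  obtains s k where "s \<in> S" "k \<in> D" "\<And>i x. i \<in> D \<Longrightarrow> x \<in> I i \<Longrightarrow> s * x \<in> I k"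
proof -
  let ?U = "\<Union>i\<in>D. I i"
  have "semiring_ideal ?U"
    using assms(2-4) by (rule semiring_ideal_directed_UN)
  moreover have "?U \<inter> S = {}"
    using disjoint by blast
  ultimately have "S_finite S ?U"
    using \<open>S_Noetherian S\<close> by (simp add: S_Noetherian_def)
  then obtain s F where "s \<in> S" "finite F" and sU: "(*) s ` ?U \<subseteq> semiring_ideal hull F"
    and FU: "semiring_ideal hull F \<subseteq> ?U"
    by (auto simp: S_finite_def finitely_generated_ideal_def)
  have "F \<subseteq> ?U"
    using hull_subset FU by (rule subset_trans)
  then obtain k where "k \<in> D" "F \<subseteq> I k"
    using finite_subset_directed_UN[OF \<open>finite F\<close> \<open>D \<noteq> {}\<close> _ directed] by blast
  then have "semiring_ideal hull F \<subseteq> I k"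
    by (intro hull_minimal ideal)
  with sU have "s * x \<in> I k" if "i \<in> D" "x \<in> I i" for i x
    using that by blast
  with \<open>s \<in> S\<close> \<open>k \<in> D\<close> show ?thesis by (rule that)
qed

text \<open>The quotients of \<open>A\<close> by \<open>s\<close> and by \<open>t\<close> both lie
  in the quotient by \<open>s * t\<close>, and they avoid \<open>S\<close> because \<open>A\<close>
  does. If \<open>t\<close> maps all of them into the quotient by \<open>k\<close>, then
  \<open>k * t\<close> serves as \<open>u\<close>.\<close>

lemma uniform_multiplier:
  assumes "S_Noetherian S" and S: "multiplicative_subset S"
    and A: "semiring_ideal A" and "A \<inter> S = {}"
  obtains u where "u \<in> S" "\<And>s x. s \<in> S \<Longrightarrow> s * x \<in> A \<Longrightarrow> u * x \<in> A"
proof -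
  have S_mult: "s * t \<in> S" if "s \<in> S" "t \<in> S" for s t
    using S that by (simp add: multiplicative_subset_def)
  obtain t k where "t \<in> S" "k \<in> S" and *: "\<And>s x. s \<in> S \<Longrightarrow> x \<in> ideal_quotient A s \<Longrightarrow>
      t * x \<in> ideal_quotient A k"
  proof (rule S_Noetherian_directed_stationary[OF \<open>S_Noetherian S\<close>, of S "ideal_quotient A"])
    show "S \<noteq> {}"
      using S by (auto simp: multiplicative_subset_def)
    show "semiring_ideal (ideal_quotient A s)" for s
      using A by (rule semiring_ideal_quotient)
    show "\<exists>k\<in>S. ideal_quotient A s \<union> ideal_quotient A t \<subseteq> ideal_quotient A k"
      if "s \<in> S" "t \<in> S" for s t
      using ideal_quotient_mono[OF A, of t s] ideal_quotient_mono[OF A, of s t] S_mult[OF that]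
      by (auto simp: mult.commute)
    show "ideal_quotient A s \<inter> S = {}" if "s \<in> S" for s
      using S_mult[OF that] \<open>A \<inter> S = {}\<close> by auto
  qed blast
  show ?thesis
  proof
    show "k * t \<in> S"
      using \<open>k \<in> S\<close> \<open>t \<in> S\<close> by (rule S_mult)
    show "k * t * x \<in> A" if "s \<in> S" "s * x \<in> A" for s x
      using *[of s x] that by (simp add: mult.assoc)
  qed
qed

text \<open>Modulo \<open>A\<close>, an element \<open>x\<close> of the second ideal is a multiple
  \<open>d * c\<close> up to sign, while \<open>b * x\<close> lies in \<open>A\<close> because
  \<open>x\<close> is in the first. So \<open>b * c * d\<close> lies in \<open>A\<close>, then
  \<open>t * (c * d)\<close> by \<open>stationary\<close>, and hence \<open>t * x\<close>. The
  intended \<open>c\<close> is a power of \<open>b\<close>.\<close>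

lemma k_adjoin_Int_subset:
  fixes A :: "'a::comm_semiring_1 set"
  assumes canc: "additively_cancellative TYPE('a)" and yoked: "yoked TYPE('a)"
    and kA: "k_ideal A" and ab: "a * b \<in> A"
    and stationary: "\<And>d. b * c * d \<in> A \<Longrightarrow> t * (c * d) \<in> A"
  shows "(*) t ` (k_adjoin A a \<inter> k_adjoin A c) \<subseteq> A"
proof clarify
  fix x assume xa: "x \<in> k_adjoin A a" and xc: "x \<in> k_adjoin A c"
  note A = k_ideal_imp_semiring_ideal[OF kA]
  note add = semiring_ideal_add[OF A] and mult = semiring_ideal_mult[OF A]
  have cancel: "y \<in> A" if "z + y \<in> A" "z \<in> A" for y z
    using k_ideal_cancel[OF kA] that .
  \<comment> \<open>As \<open>a * b\<close> is in \<open>A\<close>, multiplying the equation for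
    \<open>x\<close> by \<open>b\<close> puts every term other than \<open>b * x\<close> into
    \<open>A\<close>.\<close>
  have bx: "b * x \<in> A"
  proof -
    obtain p q r r' where pq: "p \<in> A" "q \<in> A" and x: "x + (p + r * a) = q + r' * a"
      using xa by (rule k_adjoinE)
    have "(b * p + r * (a * b)) + b * x = b * (x + (p + r * a))"
      by (simp add: algebra_simps)
    also have "\<dots> = b * q + r' * (a * b)"
      unfolding x by (simp add: algebra_simps)
    also have "\<dots> \<in> A"
      by (simp add: add mult pq ab)
    finally show ?thesis
      by (rule cancel) (simp add: add mult pq ab)
  qed
  obtain p q r r' where pq: "p \<in> A" "q \<in> A" and x: "x + (p + r * c) = q + r' * c"
    using xc by (rule k_adjoinE)
  \<comment> \<open>Yokedness supplies the difference of \<open>r\<close> and \<open>r'\<close> in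
    one of the two directions; cancelling the common multiple of \<open>c\<close> then leaves the
    single term \<open>d * c\<close>.\<close>
  obtain d where "r + d = r' \<or> r' + d = r"
    using yoked by (auto simp: yoked_def)
  then show "t * x \<in> A"
  proof
    assume "r + d = r'"
    then have "(x + p) + r * c = (q + d * c) + r * c"
      using x by (auto simp: algebra_simps)
    then have eq: "x + p = q + d * c"
      using canc unfolding additively_cancellative_def by blast
    \<comment> \<open>The equation \<open>eq\<close> is used twice: multiplied by \<open>b\<close>
      to isolate \<open>b * c * d\<close>, then by \<open>t\<close> to isolate
      \<open>t * x\<close>.\<close>
    have "b * q + b * c * d = b * (q + d * c)"
      by (simp add: algebra_simps)
    also have "\<dots> = b * x + b * p"
      unfolding eq[symmetric] by (simp add: algebra_simps)
    also have "\<dots> \<in> A"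
      by (simp add: add mult bx pq)
    finally have "b * c * d \<in> A"
      by (rule cancel) (simp add: add mult pq)
    then have "t * q + t * (c * d) \<in> A"
      by (simp add: add mult stationary pq)
    also have "t * q + t * (c * d) = t * (q + d * c)"
      by (simp add: algebra_simps)
    also have "\<dots> = t * p + t * x"
      unfolding eq[symmetric] by (simp add: algebra_simps)
    finally show ?thesis
      by (rule cancel) (simp add: add mult pq)
  next
    assume "r' + d = r"
    then have "(x + p + d * c) + r' * c = q + r' * c"
      using x by (auto simp: algebra_simps)
    then have eq: "x + p + d * c = q"
      using canc unfolding additively_cancellative_def by blast
    \<comment> \<open>Here \<open>d * c\<close> stands on the side of \<open>x\<close>, so
      \<open>t * (c * d)\<close> is among the summands removed by the k-ideal property at the
      end.\<close>
    have "(b * x + b * p) + b * c * d = b * (x + p + d * c)"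
      by (simp add: algebra_simps)
    also have "\<dots> \<in> A"
      unfolding eq by (simp add: add mult pq)
    finally have "b * c * d \<in> A"
      by (rule cancel) (simp add: add mult bx pq)
    then have "t * p + t * (c * d) \<in> A"
      by (simp add: add mult stationary pq)
    moreover have "(t * p + t * (c * d)) + t * x = t * (x + p + d * c)"
      by (simp add: algebra_simps)
    then have "(t * p + t * (c * d)) + t * x \<in> A"
      unfolding eq using pq by (simp add: mult)
    ultimately show ?thesis
      by (rule cancel[rotated])
  qed
qed

theorem theorem1p6:
  fixes S :: "'a::comm_semiring_1 set"
  assumes "additively_cancellative TYPE('a)"
    and "zerosumfree TYPE('a)"
    and "yoked TYPE('a)"
    and "multiplicative_subset S"
    and "S_Noetherian S"
  shows "\<forall>A. S_k_irreducible S A \<longrightarrow> S_k_primary S A"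
proof (intro allI impI)
  fix A assume irr: "S_k_irreducible S A"
  then have kA: "k_ideal A" and disj: "A \<inter> S = {}"
    by (auto simp: S_k_irreducible_def)
  note A = k_ideal_imp_semiring_ideal[OF kA]
  have S_mult: "s * t \<in> S" if "s \<in> S" "t \<in> S" for s t
    using assms(4) that by (simp add: multiplicative_subset_def)
  obtain u where "u \<in> S" and u: "\<And>s x. s \<in> S \<Longrightarrow> s * x \<in> A \<Longrightarrow> u * x \<in> A"
    using uniform_multiplier[OF assms(5,4) A disj] by blast
  have u_radical: "u * b \<in> radical A" if "s \<in> S" "s * b ^ n \<in> A" for s b n
  proof -
    have "u * b ^ n \<in> A"
      using that by (rule u)
    \<comment> \<open>The factor \<open>u ^ n\<close> balances the exponents of \<open>u\<close> and
      \<open>b\<close>; the extra \<open>b\<close> makes the exponent \<open>Suc n\<close>, hence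
      positive even for \<open>n = 0\<close>.\<close>
    then have "(u ^ n * b) * (u * b ^ n) \<in> A"
      by (rule semiring_ideal_mult[OF A])
    also have "(u ^ n * b) * (u * b ^ n) = (u * b) ^ Suc n"
      by (simp add: algebra_simps)
    finally show ?thesis
      unfolding radical_def by (intro CollectI exI[of _ "Suc n"]) simp
  qed
  have "u * a \<in> A \<or> u * b \<in> radical A" if ab: "a * b \<in> A" for a b
  proof (cases "\<exists>s\<in>S. \<exists>n. s * b ^ n \<in> A")
    case True
    then show ?thesis using u_radical by blast
  next
    \<comment> \<open>This case says exactly that every quotient of \<open>A\<close> by a power of
      \<open>b\<close> is disjoint from \<open>S\<close>.\<close>
    case False
    obtain t k where "t \<in> S"
      and stationary: "\<And>n x. x \<in> ideal_quotient A (b ^ n) \<Longrightarrow> t * x \<in> ideal_quotient A (b ^ k)"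
    proof (rule S_Noetherian_directed_stationary
        [OF assms(5), of "UNIV :: nat set" "\<lambda>n. ideal_quotient A (b ^ n)"])
      show "semiring_ideal (ideal_quotient A (b ^ n))" for n
        using A by (rule semiring_ideal_quotient)
      show "\<exists>k\<in>UNIV. ideal_quotient A (b ^ m) \<union> ideal_quotient A (b ^ n) \<subseteq> ideal_quotient A (b ^ k)"
        for m n
        using ideal_quotient_mono[OF A, of "b ^ m" "b ^ n"]
          ideal_quotient_mono[OF A, of "b ^ n" "b ^ m"]
        by (intro bexI[of _ "m + n"]) (auto simp: power_add mult.commute)
      show "ideal_quotient A (b ^ n) \<inter> S = {}" for n
        using False by (auto simp: mult.commute)
    qed auto
    have "(*) t ` (k_adjoin A a \<inter> k_adjoin A (b ^ k)) \<subseteq> A"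
      using assms(1,3) kA ab
    proof (rule k_adjoin_Int_subset)
      \<comment> \<open>Since \<open>b * b ^ k\<close> is \<open>b ^ Suc k\<close>, only the step
        from \<open>k\<close> to \<open>Suc k\<close> of the stationary chain is used.\<close>
      show "t * (b ^ k * d) \<in> A" if "b * b ^ k * d \<in> A" for d
        using stationary[of d "Suc k"] that by (simp add: mult.left_commute)
    qed
    then obtain s where "s \<in> S"
      and s: "(*) (t * s) ` k_adjoin A a \<subseteq> A \<or> (*) (t * s) ` k_adjoin A (b ^ k) \<subseteq> A"
      using irr \<open>t \<in> S\<close> k_ideal_k_adjoin[OF A] subset_k_adjoin[OF A]
      unfolding S_k_irreducible_def by (meson Int_greatest)
    \<comment> \<open>Evaluating at the adjoined elements \<open>a\<close> and \<open>b ^ k\<close>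
      leaves a multiplier \<open>t * s\<close> that depends on \<open>a\<close> and
      \<open>b\<close>; \<open>u\<close> then replaces it.\<close>
    then have "t * s * a \<in> A \<or> t * s * b ^ k \<in> A"
      using mem_k_adjoin[OF A] by blast
    then show ?thesis
      using u u_radical S_mult[OF \<open>t \<in> S\<close> \<open>s \<in> S\<close>] by blast
  qed
  then show "S_k_primary S A"
    using \<open>u \<in> S\<close> A kA disj unfolding S_k_primary_def S_primary_def by blast
qed

end
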